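(* Let $\sigma,\tau\in\mathcal S_k$ be distinct, and suppose that there exists $j\in[k-1]$ such that (i) $\sigma_i=\tau_i$ for $1\le i\le j$, (ii) $\sigma$ and $\tau$ are non-$(j+1)$-overlapping, and (iii) each of $\sigma$ and $\tau$ is non-$(j+1)$-self-overlapping. Then $\sigma\equiv\tau$.
   Context: $\mathcal S_k$ is the set of permutations of $[k]=\{1,\dots,k\}$ in one-line notation. For a sequence of distinct reals, $\mathrm{st}$ replaces the smallest entry by $1$, the second smallest by $2$, etc. For any $\sigma,\tau\in\mathcal S_k$ (possibly equal), let $$\mathcal B_{\sigma,\tau}=\{i\in[k-1]:\mathrm{st}(\sigma_{k-i+1}\dots\sigma_k)=\mathrm{st}(\tau_1\dots\tau_i)\}.$$ For $j\ge2$, $\sigma$ and $\tau$ are non-$j$-overlapping if $\mathcal B_{\sigma,\tau}\cup\mathcal B_{\tau,\sigma}\subseteq[j-1]$, and $\sigma$ is non-$j$-self-overlapping if $\mathcal B_{\sigma,\sigma}\subseteq[j-1]$. Let $X_1,X_2,\dots$ be i.i.d. continuous random variables (e.g. uniform on $[0,1]$). A consecutive occurrence of $\sigma\in\mathcal S_k$ is a block $X_i,\dots,X_{i+k-1}$ with $\mathrm{st}(X_i\dots X_{i+k-1})=\sigma$. For distinct $\sigma,\tau\in\mathcal S_k$, $\Pr(\sigma\prec\tau)$ is the probability that the first consecutive occurrence of $\sigma$ appears before the first consecutive occurrence of $\tau$. We write $\sigma\equiv\tau$ if $\Pr(\sigma\prec\tau)=\Pr(\tau\prec\sigma)=\frac12$.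 *)

theory Defs
  imports "HOL-Probability.Probability" "HOL-Combinatorics.Multiset_Permutations"
    "HOL-Library.Extended_Nat"
begin

text \<open>A permutation of \<open>{1..k}\<close> in one-line notation is a list in
  \<^term>\<open>permutations_of_set {1..k::nat}\<close>. Lists are indexed from \<open>0\<close>, so the entry
  \<open>\<sigma>\<^sub>i\<close> is \<open>\<sigma> ! (i - 1)\<close>.\<close>

definition st :: "'a::linorder list \<Rightarrow> nat list" where
  "st xs = map (\<lambda>x. card {y \<in> set xs. y \<le> x}) xs"

text \<open>The set \<open>\<B>\<^bsub>\<sigma>,\<tau>\<^esub>\<close>, for \<open>\<sigma>\<close> and \<open>\<tau>\<close> of the same length.\<close>

definition overlaps :: "nat list \<Rightarrow> nat list \<Rightarrow> nat set" where
  "overlaps \<sigma> \<tau> =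
     {i \<in> {1..length \<sigma> - 1}. st (drop (length \<sigma> - i) \<sigma>) = st (take i \<tau>)}"

definition non_overlapping :: "nat \<Rightarrow> nat list \<Rightarrow> nat list \<Rightarrow> bool" where
  "non_overlapping j \<sigma> \<tau> \<longleftrightarrow> overlaps \<sigma> \<tau> \<union> overlaps \<tau> \<sigma> \<subseteq> {1..j - 1}"

definition non_self_overlapping :: "nat \<Rightarrow> nat list \<Rightarrow> bool" where
  "non_self_overlapping j \<sigma> \<longleftrightarrow> overlaps \<sigma> \<sigma> \<subseteq> {1..j - 1}"

text \<open>The random variables are \<open>X 1, X 2, \<dots>\<close>; the value \<open>X 0\<close> is never used. A continuous random
  variable is one whose distribution function is continuous; a density is not required.\<close>

definition iid_continuous :: "'a measure \<Rightarrow> (nat \<Rightarrow> 'a \<Rightarrow> real) \<Rightarrow> bool" where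
  "iid_continuous M X \<longleftrightarrow>
     prob_space M \<and>
     prob_space.indep_vars M (\<lambda>_. borel) X {1..} \<and>
     (\<forall>i\<ge>1. distr M borel (X i) = distr M borel (X 1)) \<and>
     continuous_on UNIV (cdf (distr M borel (X 1)))"

definition occurs_at :: "(nat \<Rightarrow> real) \<Rightarrow> nat list \<Rightarrow> nat \<Rightarrow> bool" where
  "occurs_at x \<sigma> i \<longleftrightarrow> st (map x [i..<i + length \<sigma>]) = \<sigma>"

text \<open>The infimum is \<open>\<infinity>\<close> if \<open>\<sigma>\<close> never occurs.\<close>

definition first_occurrence :: "(nat \<Rightarrow> real) \<Rightarrow> nat list \<Rightarrow> enat" where
  "first_occurrence x \<sigma> = (INF i \<in> {i. 1 \<le> i \<and> occurs_at x \<sigma> i}. enat i)"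

definition prob_precedes ::
  "'a measure \<Rightarrow> (nat \<Rightarrow> 'a \<Rightarrow> real) \<Rightarrow> nat list \<Rightarrow> nat list \<Rightarrow> real" where
  "prob_precedes M X \<sigma> \<tau> =
     measure M {\<omega> \<in> space M.
       first_occurrence (\<lambda>i. X i \<omega>) \<sigma> < first_occurrence (\<lambda>i. X i \<omega>) \<tau>}"

definition pattern_equiv ::
  "'a measure \<Rightarrow> (nat \<Rightarrow> 'a \<Rightarrow> real) \<Rightarrow> nat list \<Rightarrow> nat list \<Rightarrow> bool" where
  "pattern_equiv M X \<sigma> \<tau> \<longleftrightarrow>
     prob_precedes M X \<sigma> \<tau> = 1 / 2 \<and> prob_precedes M X \<tau> \<sigma> = 1 / 2"

end

theory Submission imports Defs begin

text \<open>
  Write \<open>A p\<close> for the event that \<open>\<sigma>\<close> occurs at \<open>p\<close> and neither pattern occurs earlier, and \<open>B p\<close>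
  for the same event with the two patterns exchanged. Since distinct patterns cannot occur at the
  same position, \<open>\<sigma> \<prec> \<tau>\<close> is the disjoint union of the events \<open>A p\<close>, and \<open>\<tau> \<prec> \<sigma>\<close> that of the
  events \<open>B p\<close>. It therefore suffices that \<open>A p\<close> and \<open>B p\<close> have the same probability for each \<open>p\<close>
  and that some pattern occurs almost surely.

  For the first claim, fix \<open>p\<close>. One permutation of the \<open>k\<close> coordinates in the window starting at
  \<open>p\<close> turns every occurrence of \<open>\<sigma>\<close> there into an occurrence of \<open>\<tau>\<close>. Because \<open>\<sigma>\<close> and \<open>\<tau>\<close> share
  their first \<open>j\<close> entries, it fixes the first \<open>j\<close> coordinates of the window. The new sequence has
  no earlier occurrence of a pattern: by the overlap hypotheses, such an occurrence would share at
  most \<open>j\<close> positions with the occurrence of \<open>\<tau>\<close> at \<open>p\<close>, so it would lie entirely in coordinates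
  that the permutation did not move, and would have been present in the old sequence. Hence the
  permutation maps \<open>A p\<close> into \<open>B p\<close> (\<open>first_at_permute_window\<close>). As i.i.d. variables are
  exchangeable (\<open>iid_permute_distr\<close>), the probability of \<open>A p\<close> is at most that of \<open>B p\<close>
  (\<open>prob_first_at_le\<close>), and exchanging the roles of \<open>\<sigma>\<close> and \<open>\<tau>\<close> gives equality.

  For the second claim (\<open>AE_occurs\<close>), continuity of the distribution function yields \<open>k\<close>
  successive intervals of equal positive probability. A block of \<open>k\<close> variables whose values fall
  into these intervals in the order prescribed by \<open>\<sigma>\<close> is an occurrence of \<open>\<sigma>\<close>; disjoint blocks
  are independent and succeed with the same positive probability, so almost surely one succeeds.
\<close>

section \<open>Patterns and standardization\<close>

text \<open>This replaces ranks by pairwise comparisons. Comparisons pass to sublists without any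
  computation, and they are visibly measurable.\<close>

lemma st_eq_iff:
  fixes xs :: "'a::linorder list" and ys :: "'b::linorder list"
  assumes len: "length xs = length ys"
  shows "st xs = st ys \<longleftrightarrow>
    (\<forall>a<length ys. \<forall>b<length ys. xs ! a \<le> xs ! b \<longleftrightarrow> ys ! a \<le> ys ! b)"
proof
  \<comment> \<open>Taking ranks preserves and reflects the order.\<close>
  have rank_le_iff: "st zs ! a \<le> st zs ! b \<longleftrightarrow> zs ! a \<le> zs ! b"
    if "a < length zs" "b < length zs" for zs :: "'c::linorder list" and a b
  proof (cases "zs ! a \<le> zs ! b")
    case True
    then show ?thesis
      using that by (auto simp: st_def intro!: card_mono)
  next
    case False
    then have "{y \<in> set zs. y \<le> zs ! b} \<subset> {y \<in> set zs. y \<le> zs ! a}"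
      using that by (auto simp: psubset_eq set_eq_iff intro: nth_mem)
    from psubset_card_mono[OF _ this] False that show ?thesis
      by (simp add: st_def)
  qed
  {
    assume "st xs = st ys"
    then show "\<forall>a<length ys. \<forall>b<length ys. xs ! a \<le> xs ! b \<longleftrightarrow> ys ! a \<le> ys ! b"
      using rank_le_iff[of _ xs] rank_le_iff[of _ ys] len by simp
  }
  assume iso: "\<forall>a<length ys. \<forall>b<length ys. xs ! a \<le> xs ! b \<longleftrightarrow> ys ! a \<le> ys ! b"
  \<comment> \<open>Order isomorphic lists differ by a strictly increasing relabelling \<open>f\<close> of the entries; equal
    entries of \<open>xs\<close> correspond to equal entries of \<open>ys\<close>, so the choice of the index is immaterial.\<close>
  define f where "f s = ys ! (SOME m. m < length xs \<and> xs ! m = s)" for s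
  have f: "f (xs ! a) = ys ! a" if "a < length xs" for a
  proof -
    define m where "m = (SOME m. m < length xs \<and> xs ! m = xs ! a)"
    have m: "m < length xs \<and> xs ! m = xs ! a"
      unfolding m_def by (rule someI[of _ a]) (simp add: that)
    then have "ys ! m \<le> ys ! a" "ys ! a \<le> ys ! m"
      using iso that len by (metis order.refl)+
    then show ?thesis by (simp add: f_def m_def)
  qed
  then have ys: "ys = map f xs"
    using len by (auto intro: nth_equalityI)
  have le: "f s \<le> f t \<longleftrightarrow> s \<le> t" if "s \<in> set xs" "t \<in> set xs" for s t
    using that iso f len by (auto simp: in_set_conv_nth)
  have inj: "inj_on f (set xs)"
    by (rule inj_onI, rule order.antisym) (simp_all flip: le)
  have "card {y \<in> set ys. y \<le> f s} = card {y \<in> set xs. y \<le> s}" if "s \<in> set xs" for s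
  proof -
    have "{y \<in> set ys. y \<le> f s} = f ` {y \<in> set xs. y \<le> s}"
      using le that by (auto simp: ys)
    then show ?thesis
      using inj by (simp add: card_image inj_on_subset)
  qed
  then show "st xs = st ys"
    by (simp add: st_def ys)
qed

lemma st_permutation:
  assumes "\<sigma> \<in> permutations_of_set {1..k}"
  shows "st \<sigma> = \<sigma>"
proof -
  have "set \<sigma> = {1..k}" using assms by (rule permutations_of_setD)
  moreover have "{y \<in> {1..k}. y \<le> s} = {1..s}" if "s \<in> {1..k}" for s
    using that by auto
  ultimately show ?thesis
    by (auto simp: st_def intro!: map_idI)
qed

lemma length_permutation:
  "\<sigma> \<in> permutations_of_set {1..k} \<Longrightarrow> length \<sigma> = k"
  by (simp add: length_finite_permutations_of_set)

lemma nth_permutation_mem: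
  assumes "\<sigma> \<in> permutations_of_set {1..k}" "m < k"
  shows "\<sigma> ! m \<in> {1..k}"
  using assms nth_mem[of m \<sigma>] by (auto simp: permutations_of_setD length_permutation)

lemma occurs_at_iff:
  assumes "\<sigma> \<in> permutations_of_set {1..k}"
  shows "occurs_at x \<sigma> i \<longleftrightarrow>
    (\<forall>a<k. \<forall>b<k. x (i + a) \<le> x (i + b) \<longleftrightarrow> \<sigma> ! a \<le> \<sigma> ! b)"
  using st_eq_iff[of "map x [i..<i + k]" \<sigma>] st_permutation[OF assms] length_permutation[OF assms]
  by (simp add: occurs_at_def)

lemma occurs_at_unique:
  "occurs_at x \<sigma> i \<Longrightarrow> occurs_at x \<tau> i \<Longrightarrow> length \<sigma> = length \<tau> \<Longrightarrow> \<sigma> = \<tau>"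
  by (simp add: occurs_at_def)

lemma occurs_at_cong:
  assumes "\<And>m. i \<le> m \<Longrightarrow> m < i + length \<sigma> \<Longrightarrow> x m = y m"
  shows "occurs_at x \<sigma> i \<longleftrightarrow> occurs_at y \<sigma> i"
proof -
  have "map x [i..<i + length \<sigma>] = map y [i..<i + length \<sigma>]"
    using assms by auto
  then show ?thesis by (simp only: occurs_at_def)
qed

text \<open>If the windows at \<open>q < p\<close> intersect, their common part is a suffix of the first occurrence and
  a prefix of the second, with one and the same standardization. Its length is thus an element of
  \<open>\<B>\<^bsub>\<rho>,\<tau>\<^esub>\<close>. The conclusion says that this length is at most \<open>j\<close>, and holds trivially for
  disjoint windows.\<close>

lemma occurrences_overlap_le:
  assumes \<rho>: "\<rho> \<in> permutations_of_set {1..k}" and \<tau>: "\<tau> \<in> permutations_of_set {1..k}"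
    and occ: "occurs_at x \<rho> q" "occurs_at x \<tau> p" and "q < p"
    and ov: "overlaps \<rho> \<tau> \<subseteq> {1..j}"
  shows "q + k \<le> p + j"
proof (rule ccontr)
  define i where "i = q + k - p"
  assume "\<not> q + k \<le> p + j"
  then have i: "j < i" "i < k" "q + (k - i) = p"
    using \<open>q < p\<close> by (auto simp: i_def)
  have "st (drop (k - i) \<rho>) = st (take i \<tau>)"
  proof (subst st_eq_iff)
    show "length (drop (k - i) \<rho>) = length (take i \<tau>)"
      using i \<rho> \<tau> by (simp add: length_permutation)
    have "\<rho> ! (k - i + a) \<le> \<rho> ! (k - i + b) \<longleftrightarrow> \<tau> ! a \<le> \<tau> ! b" if "a < i" "b < i" for a b
    proof -
      have "k - i + a < k" "k - i + b < k" using i that by auto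
      then have "x (p + a) \<le> x (p + b) \<longleftrightarrow> \<rho> ! (k - i + a) \<le> \<rho> ! (k - i + b)"
        using occ(1) unfolding occurs_at_iff[OF \<rho>] i(3)[symmetric] add.assoc by blast
      moreover have "x (p + a) \<le> x (p + b) \<longleftrightarrow> \<tau> ! a \<le> \<tau> ! b"
        using occ(2) i that unfolding occurs_at_iff[OF \<tau>] by auto
      ultimately show ?thesis by simp
    qed
    then show "\<forall>a<length (take i \<tau>). \<forall>b<length (take i \<tau>).
        drop (k - i) \<rho> ! a \<le> drop (k - i) \<rho> ! b \<longleftrightarrow> take i \<tau> ! a \<le> take i \<tau> ! b"
      using i \<rho> \<tau> by (simp add: length_permutation)
  qed
  then have "i \<in> overlaps \<rho> \<tau>"
    using i \<rho> by (auto simp: overlaps_def length_permutation)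
  with ov i show False by auto
qed

section \<open>The first occurrence of either pattern\<close>

definition first_at :: "(nat \<Rightarrow> real) \<Rightarrow> nat list \<Rightarrow> nat list \<Rightarrow> nat \<Rightarrow> bool" where
  "first_at x \<sigma> \<tau> p \<longleftrightarrow>
     1 \<le> p \<and> occurs_at x \<sigma> p \<and> (\<forall>q\<in>{1..<p}. \<not> occurs_at x \<sigma> q \<and> \<not> occurs_at x \<tau> q)"

lemma first_occurrence_less_iff:
  assumes "length \<sigma> = length \<tau>" "\<sigma> \<noteq> \<tau>"
  shows "first_occurrence x \<sigma> < first_occurrence x \<tau> \<longleftrightarrow> (\<exists>p. first_at x \<sigma> \<tau> p)"
proof
  assume "first_occurrence x \<sigma> < first_occurrence x \<tau>"
  then obtain i where i: "1 \<le> i" "occurs_at x \<sigma> i" "enat i < first_occurrence x \<tau>"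
    unfolding first_occurrence_def[of x \<sigma>] INF_less_iff by auto
  define p where "p = (LEAST p. 1 \<le> p \<and> occurs_at x \<sigma> p)"
  have p: "1 \<le> p" "occurs_at x \<sigma> p" "p \<le> i"
    using LeastI[of "\<lambda>p. 1 \<le> p \<and> occurs_at x \<sigma> p" i] Least_le[of "\<lambda>p. 1 \<le> p \<and> occurs_at x \<sigma> p" i] i
    by (auto simp: p_def)
  have "\<not> occurs_at x \<sigma> q" if "1 \<le> q" "q < p" for q
    using not_less_Least[of q "\<lambda>p. 1 \<le> p \<and> occurs_at x \<sigma> p"] that by (auto simp: p_def)
  moreover have "\<not> occurs_at x \<tau> q" if "1 \<le> q" "q < p" for q
  proof
    assume "occurs_at x \<tau> q"
    then have "first_occurrence x \<tau> \<le> enat q"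
      using that by (auto simp: first_occurrence_def intro: INF_lower)
    also have "\<dots> \<le> enat i" using that p by simp
    finally show False using i(3) by simp
  qed
  ultimately show "\<exists>p. first_at x \<sigma> \<tau> p"
    using p by (auto simp: first_at_def)
next
  assume "\<exists>p. first_at x \<sigma> \<tau> p"
  then obtain p where p: "first_at x \<sigma> \<tau> p" ..
  have "first_occurrence x \<sigma> \<le> enat p"
    using p by (auto simp: first_occurrence_def first_at_def intro: INF_lower)
  also have "\<dots> < enat (Suc p)" by simp
  also have "\<dots> \<le> first_occurrence x \<tau>"
    unfolding first_occurrence_def
  proof (rule INF_greatest)
    fix q assume q: "q \<in> {i. 1 \<le> i \<and> occurs_at x \<tau> i}"
    have "q \<noteq> p" using p q occurs_at_unique[OF _ _ assms(1)] assms(2) by (auto simp: first_at_def)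
    moreover have "\<not> q < p" using p q by (auto simp: first_at_def)
    ultimately show "enat (Suc p) \<le> enat q" by simp
  qed
  finally show "first_occurrence x \<sigma> < first_occurrence x \<tau>" .
qed

lemma first_at_unique:
  assumes "first_at x \<sigma> \<tau> p" "first_at x \<sigma> \<tau> q"
  shows "p = q"
proof (cases p q rule: linorder_cases)
  case less
  with assms show ?thesis by (auto simp: first_at_def)
next
  case greater
  with assms show ?thesis by (auto simp: first_at_def)
qed

lemma ex_first_at:
  assumes "1 \<le> i" "occurs_at x \<sigma> i"
  shows "\<exists>p. first_at x \<sigma> \<tau> p \<or> first_at x \<tau> \<sigma> p"
proof -
  define Q where "Q p \<longleftrightarrow> 1 \<le> p \<and> (occurs_at x \<sigma> p \<or> occurs_at x \<tau> p)" for p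
  define p where "p = (LEAST p. Q p)"
  have "Q i" using assms by (simp add: Q_def)
  then have "Q p" unfolding p_def by (rule LeastI)
  moreover have "\<not> Q q" if "q < p" for q
    using that unfolding p_def by (rule not_less_Least)
  ultimately have "first_at x \<sigma> \<tau> p \<or> first_at x \<tau> \<sigma> p"
    by (auto simp: first_at_def Q_def)
  then show ?thesis ..
qed

section \<open>Exchanging the patterns in a window\<close>

definition permute_window :: "nat \<Rightarrow> nat \<Rightarrow> (nat \<Rightarrow> nat) \<Rightarrow> nat \<Rightarrow> nat" where
  "permute_window p k f i = (if p \<le> i \<and> i < p + k then p + f (i - p) else i)"

lemma inj_permute_window:
  assumes "f permutes {..<k}"
  shows "inj (permute_window p k f)"
proof (rule injI)
  fix a b assume *: "permute_window p k f a = permute_window p k f b"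
  have "f (i - p) < k" if "i < p + k" "p \<le> i" for i
    using permutes_in_image[OF assms, of "i - p"] that by auto
  then have "(p \<le> a \<and> a < p + k) \<longleftrightarrow> (p \<le> b \<and> b < p + k)"
    using * by (auto simp: permute_window_def split: if_splits)
  then show "a = b"
    using * permutes_inj[OF assms] by (auto simp: permute_window_def split: if_splits dest!: injD)
qed

text \<open>The permutation moves coordinates from position \<open>p + j\<close> on only. An occurrence in the permuted
  sequence that starts before \<open>p\<close> ends before \<open>p + j\<close>, by the overlap condition against the new
  occurrence of \<open>\<tau>\<close>, so it does not notice the permutation.\<close>

lemma first_at_permute_window:
  assumes \<sigma>: "\<sigma> \<in> permutations_of_set {1..k}" and \<tau>: "\<tau> \<in> permutations_of_set {1..k}"
    and f: "f permutes {..<k}" "\<And>a. a < k \<Longrightarrow> \<tau> ! a = \<sigma> ! f a"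
    and prefix: "\<And>a. a < j \<Longrightarrow> \<sigma> ! a = \<tau> ! a" and "j < k"
    and ov: "overlaps \<sigma> \<tau> \<subseteq> {1..j}" "overlaps \<tau> \<tau> \<subseteq> {1..j}"
    and first: "first_at x \<sigma> \<tau> p"
  shows "first_at (\<lambda>i. x (permute_window p k f i)) \<tau> \<sigma> p"
proof -
  define y where "y = (\<lambda>i. x (permute_window p k f i))"
  have f_less: "f a < k" if "a < k" for a
    using permutes_in_image[OF f(1), of a] that by simp
  \<comment> \<open>The entries of \<open>\<sigma>\<close> are distinct, so \<open>\<sigma>\<close> takes the value \<open>\<sigma> ! a = \<tau> ! a\<close> at the index \<open>a\<close>
    only.\<close>
  have fixes_prefix: "f a = a" if "a < j" for a
    using prefix[OF that] f(2)[of a] f_less[of a] that \<open>j < k\<close> \<sigma>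
    by (metis length_permutation nth_eq_iff_index_eq order.strict_trans permutations_of_setD(2))
  have y_eq: "y i = x i" if "i < p + j" for i
    using that fixes_prefix[of "i - p"] by (auto simp: y_def permute_window_def)
  have "occurs_at x \<sigma> p" using first by (simp add: first_at_def)
  then have occ: "occurs_at y \<tau> p"
    unfolding occurs_at_iff[OF \<sigma>] occurs_at_iff[OF \<tau>]
    by (simp add: y_def permute_window_def f(2) f_less)
  have "\<not> occurs_at y \<rho> q"
    if q: "q \<in> {1..<p}" and \<rho>: "\<rho> \<in> {\<sigma>, \<tau>}" for q \<rho>
  proof
    assume *: "occurs_at y \<rho> q"
    have perm: "\<rho> \<in> permutations_of_set {1..k}" using \<rho> \<sigma> \<tau> by auto
    have "q + k \<le> p + j"
      by (rule occurrences_overlap_le[OF perm \<tau> * occ]) (use q \<rho> ov in auto)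
    then have "occurs_at x \<rho> q"
      using * y_eq occurs_at_cong[of q \<rho> x y] length_permutation[OF perm] by auto
    with first q \<rho> show False by (auto simp: first_at_def)
  qed
  with occ first show ?thesis
    by (auto simp: first_at_def y_def)
qed

section \<open>Exchangeability\<close>

lemma iid_continuousD:
  assumes "iid_continuous M X"
  shows "prob_space M"
    and "prob_space.indep_vars M (\<lambda>_. borel) X {1..}"
    and "1 \<le> i \<Longrightarrow> distr M borel (X i) = distr M borel (X 1)"
    and "continuous_on UNIV (cdf (distr M borel (X 1)))"
    and "1 \<le> i \<Longrightarrow> X i \<in> borel_measurable M"
proof -
  show M: "prob_space M" and indep: "prob_space.indep_vars M (\<lambda>_. borel) X {1..}"
    and "1 \<le> i \<Longrightarrow> distr M borel (X i) = distr M borel (X 1)"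
    and "continuous_on UNIV (cdf (distr M borel (X 1)))"
    using assms unfolding iid_continuous_def by blast+
  interpret prob_space M by (rule M)
  show "1 \<le> i \<Longrightarrow> X i \<in> borel_measurable M"
    using indep unfolding indep_vars_def by auto
qed

text \<open>The joint law is the infinite power of the common marginal law, which is invariant under
  injective reindexing.\<close>

lemma iid_permute_distr:
  assumes iid: "iid_continuous M X" and inj: "inj_on f {1..}" and f: "f ` {1..} \<subseteq> {1..}"
  shows "distr M (PiM {1..} (\<lambda>_. borel)) (\<lambda>\<omega>. \<lambda>i\<in>{1..}. X (f i) \<omega>) =
    distr M (PiM {1..} (\<lambda>_. borel)) (\<lambda>\<omega>. \<lambda>i\<in>{1..}. X i \<omega>)"
proof -
  interpret prob_space M by (rule iid_continuousD(1)[OF iid])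
  let ?S = "PiM {1..} (\<lambda>_. borel) :: (nat \<Rightarrow> real) measure"
  let ?P = "PiM {1..} (\<lambda>_. distr M borel (X 1))"
  let ?X = "\<lambda>\<omega>. \<lambda>i\<in>{1..}. X i \<omega>"
  let ?f = "\<lambda>x. \<lambda>i\<in>{1..}. x (f i)"
  have rv: "X i \<in> borel_measurable M" if "i \<in> {1..}" for i
    using iid_continuousD(5)[OF iid] that by simp
  have law: "distr M ?S ?X = ?P"
  proof -
    have "distr M ?S ?X = (\<Pi>\<^sub>M i\<in>{1..}. distr M borel (X i))"
      by (subst indep_vars_iff_distr_eq_PiM'[symmetric])
        (simp_all del: One_nat_def add: rv iid_continuousD(2)[OF iid])
    also have "\<dots> = ?P"
      by (intro PiM_cong refl iid_continuousD(3)[OF iid]) auto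
    finally show ?thesis .
  qed
  have X_meas: "?X \<in> measurable M ?S" by (intro measurable_restrict rv)
  have f_meas: "?f \<in> measurable ?S ?S"
    using f by (intro measurable_restrict measurable_component_singleton) auto
  have "distr M ?S (\<lambda>\<omega>. \<lambda>i\<in>{1..}. X (f i) \<omega>) = distr M ?S (?f \<circ> ?X)"
    using f by (intro distr_cong refl) (auto simp: fun_eq_iff)
  also have "\<dots> = distr (distr M ?S ?X) ?S ?f"
    by (rule distr_distr[OF f_meas X_meas, symmetric])
  also have "\<dots> = distr ?P ?P ?f"
    unfolding law by (intro distr_cong refl sets_PiM_cong) auto
  also have "\<dots> = ?P"
    using inj f by (intro distr_PiM_reindex prob_space_distr rv) auto
  finally show ?thesis unfolding law .
qed

lemma measurable_first_at:
  assumes \<sigma>: "\<sigma> \<in> permutations_of_set {1..k}" and \<tau>: "\<tau> \<in> permutations_of_set {1..k}"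
  shows "Measurable.pred (PiM {1..} (\<lambda>_. borel)) (\<lambda>x. first_at x \<sigma> \<tau> p)"
proof (cases "1 \<le> p")
  case True
  let ?S = "PiM {1..} (\<lambda>_. borel) :: (nat \<Rightarrow> real) measure"
  have le: "Measurable.pred ?S (\<lambda>x. x m \<le> x n)" if "1 \<le> m" "1 \<le> n" for m n
    unfolding pred_def
    by (intro borel_measurable_le measurable_component_singleton) (use that in auto)
  have le_iff: "Measurable.pred ?S (\<lambda>x. x m \<le> x n \<longleftrightarrow> c)" if "1 \<le> m" "1 \<le> n" for m n c
    using le[OF that] by (cases c) (simp_all add: pred_intros_logic)
  have occ: "Measurable.pred ?S (\<lambda>x. occurs_at x \<rho> q)"
    if "\<rho> \<in> permutations_of_set {1..k}" "1 \<le> q" for \<rho> q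
    unfolding occurs_at_iff[OF that(1)]
    by (intro pred_intros_countable pred_intros_imp' le_iff) (use that(2) in auto)
  have "Measurable.pred ?S
      (\<lambda>x. occurs_at x \<sigma> p \<and> (\<forall>q\<in>{1..<p}. \<not> occurs_at x \<sigma> q \<and> \<not> occurs_at x \<tau> q))"
    using True
    by (intro pred_intros_logic pred_intros_finite occ[OF \<sigma>] occ[OF \<tau>]) auto
  then show ?thesis using True by (simp add: first_at_def)
qed (simp add: first_at_def)

text \<open>The product space lives on the indices \<open>{1..}\<close>, so its points are undefined at \<open>0\<close>; the
  event does not look there.\<close>

lemma first_at_restrict: "first_at (restrict x {1..}) \<sigma> \<tau> p \<longleftrightarrow> first_at x \<sigma> \<tau> p"
proof -
  have "occurs_at (restrict x {1..}) \<rho> q \<longleftrightarrow> occurs_at x \<rho> q" if "1 \<le> q" for \<rho> q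
    using that by (intro occurs_at_cong) auto
  then show ?thesis by (auto simp: first_at_def)
qed

text \<open>Only an inequality is needed: the permutation of coordinates is measure preserving and maps the
  left event into the right one. The reverse inequality is the same statement for the exchanged
  patterns.\<close>

lemma prob_first_at_le:
  assumes iid: "iid_continuous M X"
    and \<sigma>: "\<sigma> \<in> permutations_of_set {1..k}" and \<tau>: "\<tau> \<in> permutations_of_set {1..k}"
    and prefix: "\<And>a. a < j \<Longrightarrow> \<sigma> ! a = \<tau> ! a" and "j < k"
    and ov: "overlaps \<sigma> \<tau> \<subseteq> {1..j}" "overlaps \<tau> \<tau> \<subseteq> {1..j}"
  shows "measure M {\<omega> \<in> space M. first_at (\<lambda>i. X i \<omega>) \<sigma> \<tau> p} \<le>
    measure M {\<omega> \<in> space M. first_at (\<lambda>i. X i \<omega>) \<tau> \<sigma> p}"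
proof (cases "1 \<le> p")
  case True
  interpret prob_space M by (rule iid_continuousD(1)[OF iid])
  note rv = iid_continuousD(5)[OF iid]
  \<comment> \<open>\<open>\<tau>\<close> is a rearrangement of \<open>\<sigma>\<close>, and the same rearrangement is applied to the window.\<close>
  obtain f where f: "f permutes {..<k}" "permute_list f \<sigma> = \<tau>"
    using mset_eq_permutation[of \<tau> \<sigma>] \<sigma> \<tau>
    by (metis length_permutation mset_set_set permutations_of_setD)
  have \<tau>_nth: "\<tau> ! a = \<sigma> ! f a" if "a < k" for a
    using that f permute_list_nth[of f \<sigma> a] \<sigma> by (auto simp: length_permutation)
  define g where "g = permute_window p k f"
  have g: "inj_on g {1..}" "g ` {1..} \<subseteq> {1..}"
    unfolding g_def using inj_on_subset[OF inj_permute_window[OF f(1)] subset_UNIV] True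
    by (auto simp: permute_window_def)
  let ?S = "PiM {1..} (\<lambda>_. borel) :: (nat \<Rightarrow> real) measure"
  let ?B = "{x \<in> space ?S. first_at x \<tau> \<sigma> p}"
  have B: "?B \<in> sets ?S"
    using measurable_first_at[OF \<tau> \<sigma>, of p] by simp
  have law: "measure (distr M ?S (\<lambda>\<omega>. \<lambda>i\<in>{1..}. X (h i) \<omega>)) ?B =
      measure M {\<omega> \<in> space M. first_at (\<lambda>i. X (h i) \<omega>) \<tau> \<sigma> p}"
    and meas: "{\<omega> \<in> space M. first_at (\<lambda>i. X (h i) \<omega>) \<tau> \<sigma> p} \<in> sets M"
    if "h ` {1..} \<subseteq> {1..}" for h
  proof -
    have m: "(\<lambda>\<omega>. \<lambda>i\<in>{1..}. X (h i) \<omega>) \<in> measurable M ?S"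
      using that by (intro measurable_restrict rv) auto
    have *: "(\<lambda>\<omega>. \<lambda>i\<in>{1..}. X (h i) \<omega>) -` ?B \<inter> space M =
        {\<omega> \<in> space M. first_at (\<lambda>i. X (h i) \<omega>) \<tau> \<sigma> p}"
      using measurable_space[OF m] by (auto simp: first_at_restrict simp del: One_nat_def)
    show "measure (distr M ?S (\<lambda>\<omega>. \<lambda>i\<in>{1..}. X (h i) \<omega>)) ?B =
        measure M {\<omega> \<in> space M. first_at (\<lambda>i. X (h i) \<omega>) \<tau> \<sigma> p}"
      using measure_distr[OF m B] by (simp only: *)
    show "{\<omega> \<in> space M. first_at (\<lambda>i. X (h i) \<omega>) \<tau> \<sigma> p} \<in> sets M"
      using measurable_sets[OF m B] by (simp only: *)
  qed
  have "measure M {\<omega> \<in> space M. first_at (\<lambda>i. X i \<omega>) \<sigma> \<tau> p} \<le>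
      measure M {\<omega> \<in> space M. first_at (\<lambda>i. X (g i) \<omega>) \<tau> \<sigma> p}"
    using first_at_permute_window[OF \<sigma> \<tau> f(1) \<tau>_nth prefix \<open>j < k\<close> ov]
    by (intro finite_measure_mono meas g) (auto simp: g_def)
  also have "\<dots> = measure M {\<omega> \<in> space M. first_at (\<lambda>i. X i \<omega>) \<tau> \<sigma> p}"
    using iid_permute_distr[OF iid g] law[OF g(2)] law[of "\<lambda>i. i"] by simp
  finally show ?thesis .
qed (simp add: first_at_def)

section \<open>Almost sure occurrence\<close>

lemma ex_quantile:
  assumes "real_distribution \<mu>" "continuous_on UNIV (cdf \<mu>)" "0 < u" "u < 1"
  shows "\<exists>a. cdf \<mu> a = u"
proof -
  interpret real_distribution \<mu> by fact
  obtain a where a: "cdf \<mu> a < u"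
    using order_tendstoD(2)[OF cdf_lim_at_bot \<open>0 < u\<close>] by (auto dest: eventually_happens)
  obtain b where b: "u < cdf \<mu> b"
    using order_tendstoD(1)[OF cdf_lim_at_top_prob \<open>u < 1\<close>] by (auto dest: eventually_happens)
  have "a \<le> b"
    using a b cdf_nondecreasing[of b a] by (cases "a \<le> b") auto
  then show ?thesis
    using IVT'[of "cdf \<mu>" a u b] a b continuous_on_subset[OF assms(2)] by auto
qed

text \<open>The points \<open>a 1 < \<dots> < a (k + 1)\<close> are quantiles of levels \<open>s / (k + 2)\<close>. These levels lie
  strictly between \<open>0\<close> and \<open>1\<close>, where quantiles exist even for laws of unbounded support.\<close>

lemma ex_quantile_partition:
  fixes k :: nat
  assumes "real_distribution \<mu>" "continuous_on UNIV (cdf \<mu>)"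
  shows "\<exists>a. \<forall>s\<in>{1..k}. measure \<mu> {a s<..a (Suc s)} = 1 / (k + 2) \<and>
    (\<forall>t\<in>{1..k}. s < t \<longrightarrow> a (Suc s) \<le> a t)"
proof -
  interpret real_distribution \<mu> by fact
  have "\<forall>s. \<exists>b. s \<in> {1..Suc k} \<longrightarrow> cdf \<mu> b = s / (k + 2)"
    using ex_quantile[OF assms] by auto
  then obtain a where a: "cdf \<mu> (a s) = s / (k + 2)" if "s \<in> {1..Suc k}" for s
    by metis
  have less: "a s < a t" if "s \<in> {1..Suc k}" "t \<in> {1..Suc k}" "s < t" for s t
  proof -
    have "cdf \<mu> (a s) < cdf \<mu> (a t)"
      using that by (simp add: a divide_strict_right_mono)
    then show ?thesis using cdf_nondecreasing[of "a t" "a s"] by (cases "a s < a t") auto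
  qed
  have "measure \<mu> {a s<..a (Suc s)} = 1 / (k + 2)" if "s \<in> {1..k}" for s
    using cdf_diff_eq[OF less[of s "Suc s"]] a[of s] a[of "Suc s"] that
    by (auto simp: field_simps)
  moreover have "a (Suc s) \<le> a t" if "s \<in> {1..k}" "t \<in> {1..k}" "s < t" for s t
    using less[of "Suc s" t] that by (cases "Suc s = t") auto
  ultimately show ?thesis by blast
qed

lemma occurs_at_if_in_intervals:
  fixes a :: "nat \<Rightarrow> real"
  assumes \<sigma>: "\<sigma> \<in> permutations_of_set {1..k}"
    and a: "\<And>s t. s \<in> {1..k} \<Longrightarrow> t \<in> {1..k} \<Longrightarrow> s < t \<Longrightarrow> a (Suc s) \<le> a t"
    and x: "\<And>m. m < k \<Longrightarrow> x (i + m) \<in> {a (\<sigma> ! m)<..a (Suc (\<sigma> ! m))}"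
  shows "occurs_at x \<sigma> i"
proof -
  have less: "x (i + b) < x (i + c)" if "b < k" "c < k" "\<sigma> ! b < \<sigma> ! c" for b c
    using x[of b] x[of c] a[of "\<sigma> ! b" "\<sigma> ! c"] nth_permutation_mem[OF \<sigma>] that by force
  have inj: "b = c" if "b < k" "c < k" "\<sigma> ! b = \<sigma> ! c" for b c
    using that \<sigma> by (metis length_permutation nth_eq_iff_index_eq permutations_of_setD(2))
  show ?thesis
    unfolding occurs_at_iff[OF \<sigma>]
  proof (intro allI impI)
    fix b c assume bc: "b < k" "c < k"
    show "x (i + b) \<le> x (i + c) \<longleftrightarrow> \<sigma> ! b \<le> \<sigma> ! c"
      using less[OF bc] less[OF bc(2,1)] inj[OF bc]
      by (cases "\<sigma> ! b" "\<sigma> ! c" rule: linorder_cases) auto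
  qed
qed

text \<open>Cut the index set into consecutive blocks of length \<open>k\<close> and let \<open>box n\<close> be the set of values of
  block \<open>n\<close> that fall into the quantile intervals in the order of \<open>\<sigma>\<close>. The blocks are independent
  and each hits its box with probability \<open>c > 0\<close>, so the first \<open>N\<close> blocks all miss with probability
  \<open>(1 - c) ^ N\<close>, which tends to \<open>0\<close>.\<close>

lemma (in prob_space) AE_occurs:
  assumes iid: "iid_continuous M X" and \<sigma>: "\<sigma> \<in> permutations_of_set {1..k}"
  shows "AE \<omega> in M. \<exists>i\<ge>1. occurs_at (\<lambda>i. X i \<omega>) \<sigma> i"
proof -
  define \<mu> where "\<mu> = distr M borel (X 1)"
  note rv = iid_continuousD(5)[OF iid] and indep = iid_continuousD(2)[OF iid]
  have eq: "distr M borel (X i) = \<mu>" if "1 \<le> i" for i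
    unfolding \<mu>_def by (rule iid_continuousD(3)[OF iid that])
  have cont: "continuous_on UNIV (cdf \<mu>)"
    unfolding \<mu>_def by (rule iid_continuousD(4)[OF iid])
  have "real_distribution \<mu>"
    unfolding \<mu>_def by (intro real_distribution_distr rv) simp
  then obtain a where a_meas: "\<And>s. s \<in> {1..k} \<Longrightarrow> measure \<mu> {a s<..a (Suc s)} = 1 / (k + 2)"
    and a_le: "\<And>s t. s \<in> {1..k} \<Longrightarrow> t \<in> {1..k} \<Longrightarrow> s < t \<Longrightarrow> a (Suc s) \<le> a t"
    using ex_quantile_partition[OF _ cont, of k] by blast
  define block where "block n = {Suc (n * k)..<Suc (n * k) + k}" for n
  define I where "I n i = {a (\<sigma> ! (i - Suc (n * k)))<..a (Suc (\<sigma> ! (i - Suc (n * k))))}" for n i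
  define box where "box n = PiE (block n) (I n)" for n
  define Y where "Y n \<omega> = restrict (\<lambda>i. X i \<omega>) (block n)" for n \<omega>
  define c :: real where "c = (1 / (k + 2)) ^ k"
  have disj: "disjoint_family_on block UNIV"
  proof -
    have "block n \<inter> block n' = {}" if "n < n'" for n n'
      using mult_right_mono[of "Suc n" n' k] that by (auto simp: block_def)
    then show ?thesis
      unfolding disjoint_family_on_def by (metis Int_commute nat_neq_iff)
  qed
  have indep_Y: "indep_vars (\<lambda>n. PiM (block n) (\<lambda>_. borel)) Y UNIV"
    unfolding Y_def[abs_def]
    by (rule indep_vars_restrict[OF indep _ disj]) (auto simp: block_def)
  have rv_Y: "Y n \<in> measurable M (PiM (block n) (\<lambda>_. borel))" for n
    using indep_Y by (auto simp: indep_vars_def)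
  have box_sets: "box n \<in> sets (PiM (block n) (\<lambda>_. borel))" for n
    unfolding box_def by (intro sets_PiM_I_finite) (auto simp: block_def I_def)
  have Y_in_box: "Y n \<omega> \<in> box n \<longleftrightarrow> (\<forall>i\<in>block n. X i \<omega> \<in> I n i)" for n \<omega>
    unfolding Y_def box_def by (rule restrict_PiE_iff)
  have prob_box: "prob (Y n -` box n \<inter> space M) = c" for n
  proof (cases "k = 0")
    case True
    then show ?thesis
      by (simp add: c_def Y_in_box block_def vimage_def prob_space)
  next
    case False
    then have "block n \<noteq> {}" "finite (block n)" "block n \<subseteq> {1..}"
      by (auto simp: block_def)
    moreover have "Y n -` box n \<inter> space M = (\<Inter>i\<in>block n. X i -` I n i \<inter> space M)"
      using \<open>block n \<noteq> {}\<close> by (auto simp: Y_in_box)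
    ultimately have "prob (Y n -` box n \<inter> space M) = (\<Prod>i\<in>block n. prob (X i -` I n i \<inter> space M))"
      by (simp only:) (rule indep_varsD[OF indep], simp_all add: I_def)
    also have "\<dots> = (\<Prod>i\<in>block n. 1 / (k + 2))"
    proof (rule prod.cong[OF refl])
      fix i assume i: "i \<in> block n"
      then have "prob (X i -` I n i \<inter> space M) = measure (distr M borel (X i)) (I n i)"
        by (intro measure_distr[symmetric] rv) (auto simp: block_def I_def)
      also have "\<dots> = measure \<mu> (I n i)"
        using i by (subst eq) (auto simp: block_def)
      also have "\<dots> = 1 / (k + 2)"
        unfolding I_def using i by (intro a_meas nth_permutation_mem[OF \<sigma>]) (auto simp: block_def)
      finally show "prob (X i -` I n i \<inter> space M) = 1 / (k + 2)" .
    qed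
    also have "\<dots> = c" by (simp add: c_def block_def)
    finally show ?thesis .
  qed
  define miss where "miss N = (\<Inter>n<N. Y n -` (space (PiM (block n) (\<lambda>_. borel)) - box n) \<inter> space M)" for N
  have prob_miss: "prob (miss N) = (1 - c) ^ N" if "N > 0" for N
  proof -
    have "prob (miss N) = (\<Prod>n<N. prob (Y n -` (space (PiM (block n) (\<lambda>_. borel)) - box n) \<inter> space M))"
      unfolding miss_def using that
      by (intro indep_varsD[OF indep_Y]) (auto intro: box_sets sets.compl_sets)
    also have "\<dots> = (\<Prod>n<N. 1 - c)"
    proof (rule prod.cong[OF refl])
      fix n
      have "Y n -` (space (PiM (block n) (\<lambda>_. borel)) - box n) \<inter> space M =
          space M - (Y n -` box n \<inter> space M)"
        using measurable_space[OF rv_Y] by auto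
      then show "prob (Y n -` (space (PiM (block n) (\<lambda>_. borel)) - box n) \<inter> space M) = 1 - c"
        using prob_compl[OF measurable_sets[OF rv_Y box_sets]] by (simp add: prob_box)
    qed
    finally show ?thesis by simp
  qed
  have "(\<lambda>N. (1 - c) ^ N) \<longlonglongrightarrow> 0"
  proof (rule LIMSEQ_realpow_zero)
    have "0 < c" "c \<le> 1" by (auto simp: c_def intro!: power_le_one)
    then show "0 \<le> 1 - c" "1 - c < 1" by auto
  qed
  define never where "never = (\<Inter>N. miss (Suc N))"
  have miss_sets: "miss (Suc N) \<in> sets M" for N
    unfolding miss_def
    by (intro sets.finite_INT measurable_sets[OF rv_Y] sets.compl_sets box_sets) auto
  have never_sets: "never \<in> sets M"
    unfolding never_def using miss_sets by blast
  have "prob never \<le> (1 - c) ^ Suc N" for N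
    using finite_measure_mono[of never "miss (Suc N)"] miss_sets prob_miss[of "Suc N"]
    by (auto simp: never_def)
  then have "prob never \<le> 0"
    by (intro LIMSEQ_le_const[OF LIMSEQ_Suc[OF \<open>(\<lambda>N. (1 - c) ^ N) \<longlonglongrightarrow> 0\<close>]]) auto
  then have "never \<in> null_sets M"
    using never_sets by (auto simp: null_sets_def emeasure_eq_measure measure_le_0_iff)
  moreover have "\<exists>i\<ge>1. occurs_at (\<lambda>i. X i \<omega>) \<sigma> i" if \<omega>: "\<omega> \<in> space M" "\<omega> \<notin> never" for \<omega>
  proof -
    obtain n where "Y n \<omega> \<notin> space (PiM (block n) (\<lambda>_. borel)) - box n"
      using \<omega> by (auto simp: never_def miss_def)
    then have "Y n \<omega> \<in> box n"
      using measurable_space[OF rv_Y] \<omega> by blast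
    then have "X (Suc (n * k) + m) \<omega> \<in> I n (Suc (n * k) + m)" if "m < k" for m
      using that unfolding Y_in_box by (auto simp: block_def)
    then have "X (Suc (n * k) + m) \<omega> \<in> {a (\<sigma> ! m)<..a (Suc (\<sigma> ! m))}" if "m < k" for m
      using that by (simp add: I_def)
    then have "occurs_at (\<lambda>i. X i \<omega>) \<sigma> (Suc (n * k))"
      by (intro occurs_at_if_in_intervals[OF \<sigma>, where a = a] a_le)
    then show ?thesis by (intro exI[of _ "Suc (n * k)"]) simp
  qed
  ultimately show ?thesis
    by (intro AE_I'[of never]) auto
qed

section \<open>Equivalence of the two patterns\<close>

theorem theorem3p10:
  fixes M :: "'a measure" and X :: "nat \<Rightarrow> 'a \<Rightarrow> real"
    and k j :: nat and \<sigma> \<tau> :: "nat list"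
  assumes "iid_continuous M X"
    and "\<sigma> \<in> permutations_of_set {1..k}"
    and "\<tau> \<in> permutations_of_set {1..k}"
    and "\<sigma> \<noteq> \<tau>"
    and "j \<in> {1..k - 1}"
    and "\<forall>i\<in>{1..j}. \<sigma> ! (i - 1) = \<tau> ! (i - 1)"
    and "non_overlapping (j + 1) \<sigma> \<tau>"
    and "non_self_overlapping (j + 1) \<sigma>"
    and "non_self_overlapping (j + 1) \<tau>"
  shows "pattern_equiv M X \<sigma> \<tau>"
proof -
  note iid = assms(1) and \<sigma> = assms(2) and \<tau> = assms(3)
  interpret prob_space M by (rule iid_continuousD(1)[OF iid])
  note rv = iid_continuousD(5)[OF iid]
  have len: "length \<sigma> = length \<tau>" using \<sigma> \<tau> by (simp add: length_permutation)
  have prefix: "\<sigma> ! a = \<tau> ! a" if "a < j" for a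
    using assms(6) that by (auto dest: bspec[where x="Suc a"])
  have "j < k" using assms(5) by auto
  have ov: "overlaps \<sigma> \<tau> \<subseteq> {1..j}" "overlaps \<tau> \<sigma> \<subseteq> {1..j}"
    "overlaps \<sigma> \<sigma> \<subseteq> {1..j}" "overlaps \<tau> \<tau> \<subseteq> {1..j}"
    using assms(7-9) by (auto simp: non_overlapping_def non_self_overlapping_def)
  define E where "E \<rho> \<rho>' p = {\<omega> \<in> space M. first_at (\<lambda>i. X i \<omega>) \<rho> \<rho>' p}" for \<rho> \<rho>' p
  have E_sets: "E \<rho> \<rho>' p \<in> events"
    if "\<rho> \<in> permutations_of_set {1..k}" "\<rho>' \<in> permutations_of_set {1..k}" for \<rho> \<rho>' p
  proof -
    have "(\<lambda>\<omega>. \<lambda>i\<in>{1..}. X i \<omega>) \<in> measurable M (PiM {1..} (\<lambda>_. borel))"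
      by (intro measurable_restrict rv) auto
    from measurable_compose[OF this measurable_first_at[OF that, of p]]
    show ?thesis by (simp add: E_def first_at_restrict pred_def del: One_nat_def)
  qed
  have precedes: "prob_precedes M X \<rho> \<rho>' = prob (\<Union>p. E \<rho> \<rho>' p)"
    if "length \<rho> = length \<rho>'" "\<rho> \<noteq> \<rho>'" for \<rho> \<rho>'
    unfolding prob_precedes_def E_def
    by (intro arg_cong[of _ _ prob]) (auto simp: first_occurrence_less_iff[OF that])
  have sums: "(\<lambda>p. prob (E \<rho> \<rho>' p)) sums prob (\<Union>p. E \<rho> \<rho>' p)"
    if "\<rho> \<in> permutations_of_set {1..k}" "\<rho>' \<in> permutations_of_set {1..k}" for \<rho> \<rho>'
    using E_sets[OF that] first_at_unique
    by (intro finite_measure_UNION) (auto simp: disjoint_family_on_def E_def)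
  have "prob (E \<sigma> \<tau> p) = prob (E \<tau> \<sigma> p)" for p
    unfolding E_def
    using prob_first_at_le[OF iid \<sigma> \<tau> prefix \<open>j < k\<close> ov(1,4), of p]
      prob_first_at_le[OF iid \<tau> \<sigma> prefix[symmetric] \<open>j < k\<close> ov(2,3), of p] by simp
  then have eq: "prob_precedes M X \<sigma> \<tau> = prob_precedes M X \<tau> \<sigma>"
    using sums_unique2[OF sums[OF \<sigma> \<tau>]] sums[OF \<tau> \<sigma>] precedes len assms(4) by simp
  have "prob_precedes M X \<sigma> \<tau> + prob_precedes M X \<tau> \<sigma> =
      prob ((\<Union>p. E \<sigma> \<tau> p) \<union> (\<Union>p. E \<tau> \<sigma> p))"
  proof -
    have "(\<Union>p. E \<sigma> \<tau> p) \<inter> (\<Union>p. E \<tau> \<sigma> p) = {}"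
      using first_occurrence_less_iff[OF len assms(4)]
        first_occurrence_less_iff[OF len[symmetric] assms(4)[symmetric]]
      by (auto simp: E_def dest: order.asym)
    then show ?thesis
      using E_sets \<sigma> \<tau> len assms(4) by (subst finite_measure_Union) (auto simp: precedes)
  qed
  also have "\<dots> = 1"
  proof (subst prob_eq_1)
    show "AE \<omega> in M. \<omega> \<in> (\<Union>p. E \<sigma> \<tau> p) \<union> (\<Union>p. E \<tau> \<sigma> p)"
      using AE_occurs[OF iid \<sigma>] AE_space
    proof eventually_elim
      case (elim \<omega>)
      then show ?case using ex_first_at[of _ "\<lambda>i. X i \<omega>" \<sigma> \<tau>] by (auto simp: E_def)
    qed
  qed (use E_sets \<sigma> \<tau> in auto)
  finally show ?thesis
    using eq by (simp add: pattern_equiv_def)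
qed

end
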